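(* Let $S_6$ and $S_8$ be the sizes of the open cluster of a uniformly random vertex in bond percolation with parameter $p$ on the graph of the cube and on the graph of the octahedron, respectively. For all $p\in(0,1)$, $$E(S_6) = 1 + 3p + 6p^2 + 12p^3 + 9p^4 + 12p^5 - 81p^6 - 75p^7 + 69p^8 + 473p^9 - 777p^{10} + 447p^{11} - 91p^{12}$$ and $$E(S_8) = 1 + 4p + 12p^2 + 20p^3 - 14p^4 - 196p^5 + 12p^6 + 1316p^7 - 2815p^8 + 2824p^9 - 1564p^{10} + 464p^{11} - 58p^{12}.$$
   Context: Bond percolation with parameter $p$ on a finite simple undirected graph $\mathscr{G}=(\mathscr{V},\mathscr{E})$: $(\zeta(e))_{e\in\mathscr{E}}$ are independent Bernoulli($p$) random variables; edge $e$ is open if $\zeta(e)=1$ and closed if $\zeta(e)=0$. For a vertex $x$, the open cluster $\mathscr{C}_x$ is the set of vertices $y\in\mathscr{V}$ such that there is a path of open edges connecting $x$ and $y$ (in particular $x\in\mathscr{C}_x$). The vertex $x$ is chosen uniformly at random in $\mathscr{V}$, independently of the $\zeta(e)$, and the cluster size is $\mathrm{card}(\mathscr{C}_x)$. The graph of the cube consists of its 8 vertices and 12 edges (the 3-dimensional hypercube graph on $\{0,1\}^3$). The graph of the octahedron consists of its 6 vertices and 12 edges (the complete tripartite graph $K_{2,2,2}$). *)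

theory Defs
  imports "HOL-Probability.Probability"
begin

text \<open>
  A finite simple undirected graph is given by its set of vertices \<open>V\<close> and its set of edges
  \<open>E\<close>, every edge being a two-element set of vertices. A configuration
  \<open>\<zeta> :: 'v set \<Rightarrow> bool\<close> says which edges are open (\<open>True\<close> is the value 1, \<open>False\<close> the value 0).
\<close>

definition open_path :: "'v set set \<Rightarrow> ('v set \<Rightarrow> bool) \<Rightarrow> 'v \<Rightarrow> 'v list \<Rightarrow> 'v \<Rightarrow> bool" where
  "open_path E \<zeta> x vs y \<longleftrightarrow>
     vs \<noteq> [] \<and> hd vs = x \<and> last vs = y \<and> distinct vs \<and>
     successively (\<lambda>u v. {u, v} \<in> E \<and> \<zeta> {u, v}) vs"

definition open_cluster :: "'v set \<Rightarrow> 'v set set \<Rightarrow> ('v set \<Rightarrow> bool) \<Rightarrow> 'v \<Rightarrow> 'v set" where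
  "open_cluster V E \<zeta> x = {y \<in> V. \<exists>vs. open_path E \<zeta> x vs y}"

text \<open>
  The joint law of the edge variables, which are independent Bernoulli(\<open>p\<close>), and of a uniformly
  random vertex that is independent of them. Off \<open>E\<close> the configuration has the dummy value
  \<open>False\<close>, which plays no role.
\<close>

definition percolation_pmf :: "'v set \<Rightarrow> 'v set set \<Rightarrow> real \<Rightarrow> (('v set \<Rightarrow> bool) \<times> 'v) pmf" where
  "percolation_pmf V E p = pair_pmf (Pi_pmf E False (\<lambda>_. bernoulli_pmf p)) (pmf_of_set V)"

definition expected_cluster_size :: "'v set \<Rightarrow> 'v set set \<Rightarrow> real \<Rightarrow> real" where
  "expected_cluster_size V E p =
     measure_pmf.expectation (percolation_pmf V E p)
       (\<lambda>(\<zeta>, x). real (card (open_cluster V E \<zeta> x)))"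

definition cube_vertices :: "(nat \<times> nat \<times> nat) set" where
  "cube_vertices = {0, 1} \<times> {0, 1} \<times> {0, 1}"

text \<open>Two vertices of the cube are adjacent if they differ in exactly one coordinate.\<close>

definition cube_edges :: "(nat \<times> nat \<times> nat) set set" where
  "cube_edges =
     {{(a, b, c), (a', b', c')} | a b c a' b' c'.
        (a, b, c) \<in> cube_vertices \<and> (a', b', c') \<in> cube_vertices \<and>
        of_bool (a \<noteq> a') + of_bool (b \<noteq> b') + of_bool (c \<noteq> c') = (1 :: nat)}"

text \<open>
  The octahedron graph is the complete tripartite graph with parts \<open>{i} \<times> {0, 1}\<close> for
  \<open>i = 0, 1, 2\<close>; each part is a pair of antipodal vertices.
\<close>

definition octahedron_vertices :: "(nat \<times> nat) set" where
  "octahedron_vertices = {0, 1, 2} \<times> {0, 1}"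

definition octahedron_edges :: "(nat \<times> nat) set set" where
  "octahedron_edges =
     {{u, v} | u v. u \<in> octahedron_vertices \<and> v \<in> octahedron_vertices \<and> fst u \<noteq> fst v}"

end

theory Submission
  imports Defs
begin

text \<open>
  Averaging over the random vertex turns the expected cluster size into
  \<open>1 / card V\<close> times the expectation of \<open>\<Sum>x. card (open_cluster V E \<zeta> x)\<close>. Every cluster \<open>B\<close> is
  counted once for each of its vertices, so this sum is \<open>\<Sum>B. (card B)\<^sup>2\<close> over the clusters \<open>B\<close>,
  and it depends only on the partition of the vertices into clusters.

  That partition can be built by exploring the edges one at a time: start from singletons and, for
  each open edge, merge the blocks that meet it (\<open>sum_card_open_cluster\<close>). If \<open>F\<close> is the expectation
  that remains after the current edge has been inspected, as a function of the current partition
  \<open>\<pi>\<close>, then conditioning on the current edge gives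
  \<open>(1 - p) * F \<pi> + p * F \<pi>' = F \<pi> + p * (F \<pi>' - F \<pi>)\<close>,
  where \<open>\<pi>'\<close> is the partition after merging. Hence the expectation is a polynomial in \<open>p\<close> with
  integer coefficients, and this recursion computes its coefficient list
  (\<open>expected_cluster_size_eq_poly\<close>). For the cube and for the octahedron there are
  only \<open>2 ^ 12\<close> configurations, so unfolding the recursion yields the two polynomials.
\<close>

section \<open>Merging blocks along open edges\<close>

definition edge :: "'v \<times> 'v \<Rightarrow> 'v set" where
  "edge e = {fst e, snd e}"

text \<open>
  A partition is represented by the list of its blocks, each a list of vertices. An edge with both
  ends in one block needs no separate case: then a single block is concatenated, and at most the
  order of the blocks changes.
\<close>

fun join :: "'v \<times> 'v \<Rightarrow> 'v list list \<Rightarrow> 'v list list" where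
  "join (u, v) bs =
     concat (filter (\<lambda>B. u \<in> set B \<or> v \<in> set B) bs) #
     filter (\<lambda>B. \<not> (u \<in> set B \<or> v \<in> set B)) bs"

definition same_block :: "'v list list \<Rightarrow> 'v \<Rightarrow> 'v \<Rightarrow> bool" where
  "same_block bs x y \<longleftrightarrow> (\<exists>B\<in>set bs. x \<in> set B \<and> y \<in> set B)"

definition sum_squares :: "'v list list \<Rightarrow> int" where
  "sum_squares bs = (\<Sum>B\<leftarrow>bs. int (length B) ^ 2)"

definition singletons :: "'v list \<Rightarrow> 'v list list" where
  "singletons vs = map (\<lambda>v. [v]) vs"

lemma mset_concat_filter_split:
  "mset (concat (filter P bs)) + mset (concat (filter (\<lambda>B. \<not> P B) bs)) = mset (concat bs)"
  by (induction bs) auto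

lemma mset_concat_join: "mset (concat (join e bs)) = mset (concat bs)"
proof (cases e)
  case (Pair u v)
  show ?thesis
    using mset_concat_filter_split[of "\<lambda>B. u \<in> set B \<or> v \<in> set B" bs]
    by (simp only: Pair join.simps concat.simps mset_append)
qed

lemma mset_concat_fold_join: "mset (concat (fold join es bs)) = mset (concat bs)"
  by (induction es arbitrary: bs) (simp_all only: fold_simps mset_concat_join)

lemma same_block_join_mono: "same_block bs x y \<Longrightarrow> same_block (join e bs) x y"
  by (cases e) (fastforce simp: same_block_def)

lemma same_block_fold_join_mono: "same_block bs x y \<Longrightarrow> same_block (fold join es bs) x y"
  by (induction es arbitrary: bs) (simp_all add: same_block_join_mono)

lemma same_block_join_edge:
  assumes "u \<in> set (concat bs)" and "v \<in> set (concat bs)"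
  shows "same_block (join (u, v) bs) u v"
  using assms by (fastforce simp: same_block_def)

lemma same_block_fold_join_edge:
  assumes "(u, v) \<in> set es" and "u \<in> set (concat bs)" and "v \<in> set (concat bs)"
  shows "same_block (fold join es bs) u v"
  using assms
proof (induction es arbitrary: bs)
  case Nil
  then show ?case by simp
next
  case (Cons e es)
  have vertices: "set (concat (join e bs)) = set (concat bs)"
    by (rule mset_eq_setD[OF mset_concat_join])
  show ?case
  proof (cases "e = (u, v)")
    case True
    then show ?thesis
      using same_block_fold_join_mono[OF same_block_join_edge[OF Cons.prems(2,3)]] by simp
  next
    case False
    then have "(u, v) \<in> set es" using Cons.prems(1) by simp
    then show ?thesis
      using Cons.IH[of "join e bs"] Cons.prems(2,3) unfolding vertices by simp
  qed
qed

text \<open>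
  Merging never identifies more than the edges force: an equivalence that contains the blocks and
  the edges still contains the merged blocks.
\<close>

lemma same_block_join_sound:
  assumes C: "equivp C" "C u v" and blocks: "\<And>x y. same_block bs x y \<Longrightarrow> C x y"
    and xy: "same_block (join (u, v) bs) x y"
  shows "C x y"
proof -
  have "same_block bs x y \<or>
      (same_block bs x u \<or> same_block bs x v) \<and> (same_block bs y u \<or> same_block bs y v)"
    using xy by (auto simp: same_block_def)
  then show ?thesis
    using C blocks by (meson equivp_symp equivp_transp)
qed

lemma same_block_fold_join_sound:
  assumes C: "equivp C" and "\<And>u v. (u, v) \<in> set es \<Longrightarrow> C u v"
    and "\<And>x y. same_block bs x y \<Longrightarrow> C x y" and "same_block (fold join es bs) x y"
  shows "C x y"
  using assms(2-)
proof (induction es arbitrary: bs)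
  case Nil
  then show ?case by simp
next
  case (Cons e es)
  obtain u v where e: "e = (u, v)" by (cases e)
  have "C u v" using Cons.prems(1) e by simp
  show ?case
  proof (rule Cons.IH[of "join e bs"])
    show "C a b" if "(a, b) \<in> set es" for a b using that Cons.prems(1) by simp
    show "C a b" if "same_block (join e bs) a b" for a b
      using same_block_join_sound[OF C \<open>C u v\<close> Cons.prems(2)] that e by blast
    show "same_block (fold join es (join e bs)) x y" using Cons.prems(3) by simp
  qed
qed

section \<open>Open clusters as blocks\<close>

definition open_step :: "'v set set \<Rightarrow> ('v set \<Rightarrow> bool) \<Rightarrow> 'v \<Rightarrow> 'v \<Rightarrow> bool" where
  "open_step E \<zeta> u v \<longleftrightarrow> {u, v} \<in> E \<and> \<zeta> {u, v}"

lemma open_step_sym: "open_step E \<zeta> u v \<Longrightarrow> open_step E \<zeta> v u"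
  by (simp add: open_step_def insert_commute)

lemma equivp_open_step_rtranclp: "equivp (open_step E \<zeta>)\<^sup>*\<^sup>*"
proof (rule equivpI)
  show "reflp (open_step E \<zeta>)\<^sup>*\<^sup>*" by (simp add: reflpI)
  show "symp (open_step E \<zeta>)\<^sup>*\<^sup>*" by (rule symp_rtranclp) (auto intro: sympI open_step_sym)
  show "transp (open_step E \<zeta>)\<^sup>*\<^sup>*" by (rule transpI) simp
qed

text \<open>
  A path is self-avoiding, a chain of open steps need not be. When a step returns to a vertex of
  the path built so far, the path is cut back to its visit of that vertex.
\<close>

lemma ex_open_path_iff: "(\<exists>vs. open_path E \<zeta> x vs y) \<longleftrightarrow> (open_step E \<zeta>)\<^sup>*\<^sup>* x y"
proof
  have *: "(open_step E \<zeta>)\<^sup>*\<^sup>* (hd vs) (last vs)"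
    if "vs \<noteq> []" "successively (open_step E \<zeta>) vs" for vs
    using that
    by (induction vs rule: induct_list012) (auto intro: converse_rtranclp_into_rtranclp)
  show "(open_step E \<zeta>)\<^sup>*\<^sup>* x y" if "\<exists>vs. open_path E \<zeta> x vs y"
    using that * by (auto simp: open_path_def open_step_def[abs_def])
next
  assume "(open_step E \<zeta>)\<^sup>*\<^sup>* x y"
  then show "\<exists>vs. open_path E \<zeta> x vs y"
  proof (induction rule: rtranclp_induct)
    case base
    have "open_path E \<zeta> x [x] x" by (simp add: open_path_def)
    then show ?case ..
  next
    case (step y z)
    then obtain vs where vs: "open_path E \<zeta> x vs y" by blast
    show ?case
    proof (cases "z \<in> set vs")
      case True
      then obtain as bs where "vs = as @ z # bs" by (meson split_list)
      then have split: "vs = (as @ [z]) @ bs" by simp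
      have "successively (\<lambda>u v. {u, v} \<in> E \<and> \<zeta> {u, v}) (as @ [z])"
        using vs unfolding open_path_def split successively_append_iff[of _ "as @ [z]" bs] by blast
      then have "open_path E \<zeta> x (as @ [z]) z"
        using vs unfolding open_path_def split by (cases as) auto
      then show ?thesis ..
    next
      case False
      then have "open_path E \<zeta> x (vs @ [z]) z"
        using vs step.hyps(2)
        by (auto simp: open_path_def open_step_def successively_append_iff)
      then show ?thesis ..
    qed
  qed
qed

lemma same_block_singletons: "same_block (singletons vs) x y \<longleftrightarrow> x = y \<and> x \<in> set vs"
  by (auto simp: same_block_def singletons_def)

lemma concat_singletons: "concat (singletons vs) = vs"
  by (simp add: singletons_def)

lemma block_unique:
  assumes "distinct (concat bs)" "B \<in> set bs" "B' \<in> set bs" "x \<in> set B" "x \<in> set B'"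
  shows "B = B'"
  using assms by (induction bs) auto

text \<open>
  The final blocks are connected because merging is sound, and no open step leaves a block because
  the ends of every open edge have been merged.
\<close>

lemma open_cluster_eq_block:
  fixes vs :: "'v list" and es :: "('v \<times> 'v) list"
  defines "bs \<zeta> \<equiv> fold join (filter (\<lambda>e. \<zeta> (edge e)) es) (singletons vs)"
  assumes vs: "distinct vs" and ends: "\<And>u v. (u, v) \<in> set es \<Longrightarrow> u \<in> set vs \<and> v \<in> set vs"
    and B: "B \<in> set (bs \<zeta>)" "x \<in> set B"
  shows "open_cluster (set vs) (edge ` set es) \<zeta> x = set B"
proof -
  let ?step = "open_step (edge ` set es) \<zeta>"
  let ?es = "filter (\<lambda>e. \<zeta> (edge e)) es"
  have mset: "mset (concat (bs \<zeta>)) = mset vs"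
    unfolding bs_def mset_concat_fold_join concat_singletons ..
  have set: "set (concat (bs \<zeta>)) = set vs" by (rule mset_eq_setD[OF mset])
  have dist: "distinct (concat (bs \<zeta>))" using mset_eq_imp_distinct_iff[OF mset] vs by simp
  have connected: "?step\<^sup>*\<^sup>* x y" if "y \<in> set B" for y
  proof (rule same_block_fold_join_sound[OF equivp_open_step_rtranclp])
    show "?step\<^sup>*\<^sup>* u v" if "(u, v) \<in> set ?es" for u v
      using that by (intro r_into_rtranclp) (force simp: open_step_def edge_def)
    show "?step\<^sup>*\<^sup>* u v" if "same_block (singletons vs) u v" for u v
      using that by (simp add: same_block_singletons)
    show "same_block (fold join ?es (singletons vs)) x y"
      using B that by (auto simp: same_block_def bs_def)
  qed
  have closed: "z \<in> set B" if y: "y \<in> set B" and step: "?step y z" for y z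
  proof -
    obtain u v where uv: "(u, v) \<in> set ?es" "{u, v} = {y, z}"
      using step by (auto simp: open_step_def edge_def)
    have "same_block (bs \<zeta>) u v"
      unfolding bs_def using uv(1) ends[of u v]
      by (intro same_block_fold_join_edge) (auto simp: concat_singletons)
    then have "same_block (bs \<zeta>) y z" using uv(2) by (auto simp: same_block_def doubleton_eq_iff)
    then show ?thesis using block_unique[OF dist B(1)] y by (auto simp: same_block_def)
  qed
  have "y \<in> set B" if "?step\<^sup>*\<^sup>* x y" for y
    using that by (induction rule: rtranclp_induct) (use B closed in auto)
  then show ?thesis
    using connected set B(1) unfolding open_cluster_def ex_open_path_iff by auto
qed

text \<open>Each block contributes its size once for each of its vertices.\<close>

lemma sum_card_open_cluster:
  assumes vs: "distinct vs" and ends: "\<And>u v. (u, v) \<in> set es \<Longrightarrow> u \<in> set vs \<and> v \<in> set vs"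
  shows "(\<Sum>x\<in>set vs. int (card (open_cluster (set vs) (edge ` set es) \<zeta> x))) =
    sum_squares (fold join (filter (\<lambda>e. \<zeta> (edge e)) es) (singletons vs))"
proof -
  define bs where "bs = fold join (filter (\<lambda>e. \<zeta> (edge e)) es) (singletons vs)"
  let ?c = "\<lambda>x. int (card (open_cluster (set vs) (edge ` set es) \<zeta> x))"
  have mset: "mset (concat bs) = mset vs"
    unfolding bs_def mset_concat_fold_join concat_singletons ..
  have set: "set (concat bs) = set vs" by (rule mset_eq_setD[OF mset])
  have dist: "distinct (concat bs)" using mset_eq_imp_distinct_iff[OF mset] vs by simp
  have block: "(\<Sum>x\<leftarrow>B. ?c x) = int (length B) ^ 2" if B: "B \<in> set bs" for B
  proof -
    have "distinct B" using dist B by (simp add: distinct_concat_iff)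
    then have "?c x = int (length B)" if "x \<in> set B" for x
      using open_cluster_eq_block[OF vs ends B[unfolded bs_def] that]
      by (simp add: distinct_card)
    then have "(\<Sum>x\<leftarrow>B. ?c x) = (\<Sum>x\<leftarrow>B. int (length B))"
      by (intro arg_cong[where f = sum_list] map_cong) auto
    then show ?thesis by (simp add: sum_list_triv power2_eq_square)
  qed
  have "(\<Sum>x\<in>set vs. ?c x) = (\<Sum>x\<leftarrow>concat bs. ?c x)"
    using sum_list_distinct_conv_sum_set[OF dist, of ?c] unfolding set by (rule sym)
  also have "\<dots> = (\<Sum>B\<leftarrow>bs. \<Sum>x\<leftarrow>B. ?c x)"
    by (induction bs) auto
  also have "\<dots> = sum_squares bs"
    unfolding sum_squares_def by (intro arg_cong[where f = sum_list] map_cong refl block)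
  finally show ?thesis unfolding bs_def .
qed

section \<open>Conditioning on one edge at a time\<close>

fun add_coeffs :: "int list \<Rightarrow> int list \<Rightarrow> int list" where
  "add_coeffs [] bs = bs"
| "add_coeffs as [] = as"
| "add_coeffs (a # as) (b # bs) = (a + b) # add_coeffs as bs"

text \<open>The coefficients of \<open>(1 - p) a + p b\<close>, arranged as \<open>a + p (b - a)\<close>.\<close>

definition mix_coeffs :: "int list \<Rightarrow> int list \<Rightarrow> int list" where
  "mix_coeffs as bs = add_coeffs as (0 # add_coeffs bs (map uminus as))"

fun cluster_poly :: "('v \<times> 'v) list \<Rightarrow> 'v list list \<Rightarrow> int list" where
  "cluster_poly [] bs = [sum_squares bs]"
| "cluster_poly (e # es) bs = mix_coeffs (cluster_poly es bs) (cluster_poly es (join e bs))"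

lemma horner_sum_add_coeffs:
  "horner_sum real_of_int p (add_coeffs as bs) =
     horner_sum real_of_int p as + horner_sum real_of_int p bs"
  by (induction as bs rule: add_coeffs.induct) (simp_all add: algebra_simps)

lemma horner_sum_map_uminus:
  "horner_sum real_of_int p (map uminus as) = - horner_sum real_of_int p as"
  by (induction as) (simp_all add: algebra_simps)

lemma horner_sum_mix_coeffs:
  "horner_sum real_of_int p (mix_coeffs as bs) =
     (1 - p) * horner_sum real_of_int p as + p * horner_sum real_of_int p bs"
  by (simp add: mix_coeffs_def horner_sum_add_coeffs horner_sum_map_uminus algebra_simps)

lemma finite_set_Pi_bernoulli:
  "finite A \<Longrightarrow> finite (set_pmf (Pi_pmf A False (\<lambda>_. bernoulli_pmf p)))"
  by (rule finite_subset[OF set_Pi_pmf_subset']) (simp_all add: finite_PiE_dflt)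

lemma expectation_Pi_bernoulli_insert:
  fixes f :: "('a \<Rightarrow> bool) \<Rightarrow> real"
  assumes "finite A" and "a \<notin> A" and p: "0 \<le> p" "p \<le> 1"
  shows "measure_pmf.expectation (Pi_pmf (insert a A) False (\<lambda>_. bernoulli_pmf p)) f =
    (1 - p) * measure_pmf.expectation (Pi_pmf A False (\<lambda>_. bernoulli_pmf p)) (\<lambda>\<zeta>. f (\<zeta>(a := False)))
    + p * measure_pmf.expectation (Pi_pmf A False (\<lambda>_. bernoulli_pmf p)) (\<lambda>\<zeta>. f (\<zeta>(a := True)))"
proof -
  let ?P = "Pi_pmf A False (\<lambda>_. bernoulli_pmf p)"
  have fin: "finite (set_pmf ?P)" by (rule finite_set_Pi_bernoulli[OF assms(1)])
  have "Pi_pmf (insert a A) False (\<lambda>_. bernoulli_pmf p) =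
      bernoulli_pmf p \<bind> (\<lambda>b. map_pmf (\<lambda>\<zeta>. \<zeta>(a := b)) ?P)"
    by (simp add: Pi_pmf_insert'[OF assms(1,2)] map_pmf_def)
  then show ?thesis
    using fin p by (simp only:, subst pmf_expectation_bind[of UNIV]) (auto simp: UNIV_bool)
qed

text \<open>
  The status of the first edge decides whether its blocks are merged and does not affect the other
  edges, so conditioning on it reproduces the recursion of \<open>cluster_poly\<close>. The initial partition
  has to be arbitrary for the induction.
\<close>

lemma expectation_sum_squares:
  assumes "distinct (map edge es)" and p: "0 \<le> p" "p \<le> 1"
  shows "measure_pmf.expectation (Pi_pmf (edge ` set es) False (\<lambda>_. bernoulli_pmf p))
      (\<lambda>\<zeta>. real_of_int (sum_squares (fold join (filter (\<lambda>e. \<zeta> (edge e)) es) bs))) =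
    horner_sum real_of_int p (cluster_poly es bs)"
  using assms(1)
proof (induction es arbitrary: bs)
  case Nil
  then show ?case by simp
next
  case (Cons e es)
  have new: "edge e \<notin> edge ` set es" using Cons.prems by simp
  let ?P = "Pi_pmf (edge ` set es) False (\<lambda>_. bernoulli_pmf p)"
  let ?f = "\<lambda>es bs \<zeta>. real_of_int (sum_squares (fold join (filter (\<lambda>e. \<zeta> (edge e)) es) bs))"
  have rest: "filter (\<lambda>d. (\<zeta>(edge e := b)) (edge d)) es = filter (\<lambda>d. \<zeta> (edge d)) es" for \<zeta> b
    by (rule filter_cong[OF refl]) (metis new fun_upd_other image_eqI)
  have closed: "?f (e # es) bs (\<zeta>(edge e := False)) = ?f es bs \<zeta>" for \<zeta>
    by (simp only: filter.simps rest fun_upd_same if_False)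
  have opened: "?f (e # es) bs (\<zeta>(edge e := True)) = ?f es (join e bs) \<zeta>" for \<zeta>
    by (simp only: filter.simps rest fun_upd_same if_True fold_simps)
  have "measure_pmf.expectation (Pi_pmf (edge ` set (e # es)) False (\<lambda>_. bernoulli_pmf p))
        (?f (e # es) bs) =
      (1 - p) * measure_pmf.expectation ?P (?f es bs) +
      p * measure_pmf.expectation ?P (?f es (join e bs))"
    unfolding list.set image_insert
      expectation_Pi_bernoulli_insert[OF finite_imageI[OF finite_set] new p] closed opened ..
  also have "\<dots> = horner_sum real_of_int p (cluster_poly (e # es) bs)"
    using Cons.IH Cons.prems by (simp add: horner_sum_mix_coeffs)
  finally show ?case .
qed

text \<open>
  The random vertex is independent of the configuration, so averaging over it may be done first;
  the average is the sum of the squared cluster sizes divided by the number of vertices.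
\<close>

lemma expected_cluster_size_eq_poly:
  assumes vs: "distinct vs" "vs \<noteq> []" and es: "distinct (map edge es)"
    and ends: "\<And>u v. (u, v) \<in> set es \<Longrightarrow> u \<in> set vs \<and> v \<in> set vs"
    and p: "0 \<le> p" "p \<le> 1"
  shows "expected_cluster_size (set vs) (edge ` set es) p =
    horner_sum real_of_int p (cluster_poly es (singletons vs)) / length vs"
proof -
  let ?P = "Pi_pmf (edge ` set es) False (\<lambda>_. bernoulli_pmf p)"
  let ?c = "\<lambda>\<zeta> x. real (card (open_cluster (set vs) (edge ` set es) \<zeta> x))"
  have fin: "finite (set_pmf ?P)" by (simp add: finite_set_Pi_bernoulli)
  have sum: "(\<Sum>x\<in>set vs. ?c \<zeta> x) =
      real_of_int (sum_squares (fold join (filter (\<lambda>e. \<zeta> (edge e)) es) (singletons vs)))" for \<zeta>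
    by (simp flip: sum_card_open_cluster[OF vs(1) ends])
  have "percolation_pmf (set vs) (edge ` set es) p =
      ?P \<bind> (\<lambda>\<zeta>. map_pmf (Pair \<zeta>) (pmf_of_set (set vs)))"
    by (simp add: percolation_pmf_def pair_pmf_def map_pmf_def)
  then have "expected_cluster_size (set vs) (edge ` set es) p =
      (\<Sum>\<zeta>\<in>set_pmf ?P. pmf ?P \<zeta> *
         measure_pmf.expectation (pmf_of_set (set vs)) (?c \<zeta>))"
    using fin vs(2) by (simp add: expected_cluster_size_def pmf_expectation_bind[of "set_pmf ?P"])
  also have "\<dots> = (\<Sum>\<zeta>\<in>set_pmf ?P. pmf ?P \<zeta> * ((\<Sum>x\<in>set vs. ?c \<zeta> x) / length vs))"
    using vs by (simp add: integral_pmf_of_set distinct_card)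
  also have "\<dots> = measure_pmf.expectation ?P (\<lambda>\<zeta>. (\<Sum>x\<in>set vs. ?c \<zeta> x) / length vs)"
    by (subst integral_measure_pmf[OF fin]) auto
  also have "\<dots> = measure_pmf.expectation ?P (\<lambda>\<zeta>. \<Sum>x\<in>set vs. ?c \<zeta> x) / length vs"
    by simp
  also have "\<dots> = horner_sum real_of_int p (cluster_poly es (singletons vs)) / length vs"
    unfolding sum expectation_sum_squares[OF es p] ..
  finally show ?thesis .
qed

section \<open>The cube and the octahedron\<close>

definition cube_vertex_list :: "(nat \<times> nat \<times> nat) list" where
  "cube_vertex_list = List.product [0, 1] (List.product [0, 1] [0, 1])"

definition cube_edge_list :: "((nat \<times> nat \<times> nat) \<times> (nat \<times> nat \<times> nat)) list" where
  "cube_edge_list =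
     [((0, a, b), (1, a, b)). a \<leftarrow> [0, 1], b \<leftarrow> [0, 1]] @
     [((a, 0, b), (a, 1, b)). a \<leftarrow> [0, 1], b \<leftarrow> [0, 1]] @
     [((a, b, 0), (a, b, 1)). a \<leftarrow> [0, 1], b \<leftarrow> [0, 1]]"

definition octahedron_vertex_list :: "(nat \<times> nat) list" where
  "octahedron_vertex_list = List.product [0, 1, 2] [0, 1]"

definition octahedron_edge_list :: "((nat \<times> nat) \<times> (nat \<times> nat)) list" where
  "octahedron_edge_list =
     [((i, a), (j, b)). (i, j) \<leftarrow> [(0, 1), (0, 2), (1, 2)], a \<leftarrow> [0, 1], b \<leftarrow> [0, 1]]"

lemma set_cube_vertex_list: "set cube_vertex_list = cube_vertices"
  by (simp add: cube_vertex_list_def cube_vertices_def)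

lemma set_octahedron_vertex_list: "set octahedron_vertex_list = octahedron_vertices"
  by (simp add: octahedron_vertex_list_def octahedron_vertices_def)

text \<open>Each unordered edge appears in the list in only one of its two orientations.\<close>

lemma edge_set_eqI:
  assumes "\<And>u v. (u, v) \<in> set es \<Longrightarrow> {u, v} \<in> E"
    and "\<And>e. e \<in> E \<Longrightarrow> \<exists>u v. e = {u, v} \<and> ((u, v) \<in> set es \<or> (v, u) \<in> set es)"
  shows "edge ` set es = E"
proof
  show "edge ` set es \<subseteq> E" using assms(1) by (auto simp: edge_def)
  show "E \<subseteq> edge ` set es"
  proof
    fix e
    assume "e \<in> E"
    then obtain u v where "e = {u, v}" "(u, v) \<in> set es \<or> (v, u) \<in> set es"
      using assms(2) by blast
    then show "e \<in> edge ` set es"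
      by (auto simp: edge_def insert_commute intro: rev_image_eqI)
  qed
qed

lemma edge_cube_edge_list: "edge ` set cube_edge_list = cube_edges"
proof (rule edge_set_eqI)
  fix u v
  assume uv: "(u, v) \<in> set cube_edge_list"
  obtain a b c a' b' c' where u: "u = (a, b, c)" and v: "v = (a', b', c')"
    by (cases u, cases v) auto
  have "u \<in> cube_vertices" "v \<in> cube_vertices"
    "of_bool (a \<noteq> a') + of_bool (b \<noteq> b') + of_bool (c \<noteq> c') = (1 :: nat)"
    using uv unfolding u v cube_edge_list_def cube_vertices_def by auto
  then show "{u, v} \<in> cube_edges" unfolding cube_edges_def u v by blast
next
  fix e
  assume "e \<in> cube_edges"
  then obtain a b c a' b' c' where e: "e = {(a, b, c), (a', b', c')}"
    and coords: "a \<in> {0, 1}" "b \<in> {0, 1}" "c \<in> {0, 1}" "a' \<in> {0, 1}" "b' \<in> {0, 1}" "c' \<in> {0, 1}"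
    and diff: "of_bool (a \<noteq> a') + of_bool (b \<noteq> b') + of_bool (c \<noteq> c') = (1 :: nat)"
    unfolding cube_edges_def cube_vertices_def by blast
  have "((a, b, c), (a', b', c')) \<in> set cube_edge_list \<or>
      ((a', b', c'), (a, b, c)) \<in> set cube_edge_list"
    using coords diff by (elim insertE emptyE; simp add: cube_edge_list_def)
  then show "\<exists>u v. e = {u, v} \<and> ((u, v) \<in> set cube_edge_list \<or> (v, u) \<in> set cube_edge_list)"
    using e by blast
qed

lemma edge_octahedron_edge_list: "edge ` set octahedron_edge_list = octahedron_edges"
proof (rule edge_set_eqI)
  fix u v
  assume "(u, v) \<in> set octahedron_edge_list"
  then have "u \<in> octahedron_vertices" "v \<in> octahedron_vertices" "fst u \<noteq> fst v"
    unfolding octahedron_edge_list_def octahedron_vertices_def by auto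
  then show "{u, v} \<in> octahedron_edges" unfolding octahedron_edges_def by blast
next
  fix e
  assume "e \<in> octahedron_edges"
  then obtain u v where uv: "e = {u, v}" "u \<in> octahedron_vertices" "v \<in> octahedron_vertices"
      "fst u \<noteq> fst v"
    unfolding octahedron_edges_def by blast
  obtain i a j b where ij: "u = (i, a)" "v = (j, b)" by (cases u, cases v) auto
  have e: "e = {(i, a), (j, b)}" using uv(1) ij by simp
  have coords: "i \<in> {0, 1, 2}" "j \<in> {0, 1, 2}" "a \<in> {0, 1}" "b \<in> {0, 1}" and "i \<noteq> j"
    using uv(2-4) unfolding ij octahedron_vertices_def
    by (simp_all only: mem_Times_iff fst_conv snd_conv not_False_eq_True)
  have "((i, a), (j, b)) \<in> set octahedron_edge_list \<or>
      ((j, b), (i, a)) \<in> set octahedron_edge_list"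
    using coords \<open>i \<noteq> j\<close>
    by (elim insertE emptyE; simp add: octahedron_edge_list_def)
  then show "\<exists>u v. e = {u, v} \<and>
      ((u, v) \<in> set octahedron_edge_list \<or> (v, u) \<in> set octahedron_edge_list)"
    using e by blast
qed

text \<open>
  The expected sums of squares; the expected cluster sizes follow after division by the 8 and the 6
  vertices.
\<close>

lemma cluster_poly_cube:
  "cluster_poly cube_edge_list (singletons cube_vertex_list) =
     [8, 24, 48, 96, 72, 96, - 648, - 600, 552, 3784, - 6216, 3576, - 728]"
  by code_simp

lemma cluster_poly_octahedron:
  "cluster_poly octahedron_edge_list (singletons octahedron_vertex_list) =
     [6, 24, 72, 120, - 84, - 1176, 72, 7896, - 16890, 16944, - 9384, 2784, - 348]"
  by code_simp

theorem theorem4: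
  fixes p :: real
  assumes "0 < p" and "p < 1"
  shows "expected_cluster_size cube_vertices cube_edges p =
           1 + 3 * p + 6 * p ^ 2 + 12 * p ^ 3 + 9 * p ^ 4 + 12 * p ^ 5 - 81 * p ^ 6 - 75 * p ^ 7
           + 69 * p ^ 8 + 473 * p ^ 9 - 777 * p ^ 10 + 447 * p ^ 11 - 91 * p ^ 12 \<and>
         expected_cluster_size octahedron_vertices octahedron_edges p =
           1 + 4 * p + 12 * p ^ 2 + 20 * p ^ 3 - 14 * p ^ 4 - 196 * p ^ 5 + 12 * p ^ 6
           + 1316 * p ^ 7 - 2815 * p ^ 8 + 2824 * p ^ 9 - 1564 * p ^ 10 + 464 * p ^ 11
           - 58 * p ^ 12"
proof
  have cube: "expected_cluster_size (set cube_vertex_list) (edge ` set cube_edge_list) p =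
      horner_sum real_of_int p (cluster_poly cube_edge_list (singletons cube_vertex_list))
      / length cube_vertex_list"
  proof (rule expected_cluster_size_eq_poly)
    show "distinct (map edge cube_edge_list)"
      by (simp add: cube_edge_list_def edge_def doubleton_eq_iff)
  qed (use assms in \<open>auto simp: cube_vertex_list_def cube_edge_list_def\<close>)
  have len: "length cube_vertex_list = 8" by (simp add: cube_vertex_list_def)
  show "expected_cluster_size cube_vertices cube_edges p =
      1 + 3 * p + 6 * p ^ 2 + 12 * p ^ 3 + 9 * p ^ 4 + 12 * p ^ 5 - 81 * p ^ 6 - 75 * p ^ 7
      + 69 * p ^ 8 + 473 * p ^ 9 - 777 * p ^ 10 + 447 * p ^ 11 - 91 * p ^ 12"
    using cube unfolding set_cube_vertex_list edge_cube_edge_list cluster_poly_cube len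
    by (simp add: field_simps eval_nat_numeral)
next
  have octahedron:
    "expected_cluster_size (set octahedron_vertex_list) (edge ` set octahedron_edge_list) p =
      horner_sum real_of_int p
        (cluster_poly octahedron_edge_list (singletons octahedron_vertex_list))
      / length octahedron_vertex_list"
  proof (rule expected_cluster_size_eq_poly)
    show "distinct (map edge octahedron_edge_list)"
      by (simp add: octahedron_edge_list_def edge_def doubleton_eq_iff)
  qed (use assms in \<open>auto simp: octahedron_vertex_list_def octahedron_edge_list_def\<close>)
  have len: "length octahedron_vertex_list = 6" by (simp add: octahedron_vertex_list_def)
  show "expected_cluster_size octahedron_vertices octahedron_edges p =
      1 + 4 * p + 12 * p ^ 2 + 20 * p ^ 3 - 14 * p ^ 4 - 196 * p ^ 5 + 12 * p ^ 6
      + 1316 * p ^ 7 - 2815 * p ^ 8 + 2824 * p ^ 9 - 1564 * p ^ 10 + 464 * p ^ 11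
      - 58 * p ^ 12"
    using octahedron
    unfolding set_octahedron_vertex_list edge_octahedron_edge_list cluster_poly_octahedron len
    by (simp add: field_simps eval_nat_numeral)
qed

end
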